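(* Let $\Gamma$ be a locally finite graph with vertex set $G$ and let $S\subset G$ be a nonempty finite subset which admits a cooling function. Then $S$ contains a maximal Følner-optimal subset $S_0$; that is, there is a subset $S_0\subset S$ with maximum Følner ratio among subsets of $S$ such that every Følner-optimal subset of $S$ is contained in $S_0$.
   Context: For a finite $S\subset G$, $E(S)$ is the set of edges of $\Gamma$ having at least one vertex in $S$, and $\partial E(S)\subset E(S)$ is the set of edges having exactly one vertex in $S$. Each edge $e\in E(S)$ is given an orientation with initial vertex $i(e)$ and terminal vertex $t(e)$, where $i(e)\in S$ for $e\in\partial E(S)$. A cooling function for $S$ is a function $c:E(S)\to\mathbb R$ such that for every $s\in S$, $\sum_{i(e)=s}c(e)-\sum_{t(e)=s}c(e)\ge 1$. The Følner ratio of a nonempty $T\subset S$ is $FR(T)=|T|/|\partial E(T)|$ (since $S$ admits a cooling function, $\partial E(T)\neq\emptyset$), and $FR(\emptyset)=0$. A subset $T\subset S$ is a Følner-optimal subset of $S$ if $FR(T)=\max_{T'\subset S}FR(T')$. *)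

theory Defs
  imports Complex_Main
begin

(* Graphs are undirected; parallel edges and loops are allowed. The set  ends e  consists of
   the vertices of the edge e, so it is a singleton exactly when e is a loop. A graph without
   parallel edges or loops is the case where ends is injective on E with two-element values. *)
locale locally_finite_graph =
  fixes G :: "'v set" and E :: "'e set" and ends :: "'e \<Rightarrow> 'v set"
  assumes ends_in_G: "e \<in> E \<Longrightarrow> ends e \<subseteq> G"
    and card_ends: "e \<in> E \<Longrightarrow> card (ends e) = 1 \<or> card (ends e) = 2"
    and locally_finite: "v \<in> G \<Longrightarrow> finite {e \<in> E. v \<in> ends e}"

definition edges_of :: "'e set \<Rightarrow> ('e \<Rightarrow> 'v set) \<Rightarrow> 'v set \<Rightarrow> 'e set" where
  "edges_of E ends S = {e \<in> E. \<exists>v \<in> ends e. v \<in> S}"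

(* One end in S and the other one outside S. In particular a loop, whose two ends coincide,
   never belongs to the boundary. *)
definition edge_boundary :: "'e set \<Rightarrow> ('e \<Rightarrow> 'v set) \<Rightarrow> 'v set \<Rightarrow> 'e set" where
  "edge_boundary E ends S = {e \<in> E. (\<exists>v \<in> ends e. v \<in> S) \<and> (\<exists>v \<in> ends e. v \<notin> S)}"

definition orientation_for ::
  "'e set \<Rightarrow> ('e \<Rightarrow> 'v set) \<Rightarrow> 'v set \<Rightarrow> ('e \<Rightarrow> 'v) \<Rightarrow> ('e \<Rightarrow> 'v) \<Rightarrow> bool" where
  "orientation_for E ends S init ter \<longleftrightarrow>
     (\<forall>e \<in> edges_of E ends S. ends e = {init e, ter e}) \<and>
     (\<forall>e \<in> edge_boundary E ends S. init e \<in> S)"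

(* Only the values of c, init and ter on  edges_of E ends S  matter. *)
definition cooling_function ::
  "'e set \<Rightarrow> ('e \<Rightarrow> 'v set) \<Rightarrow> 'v set \<Rightarrow> ('e \<Rightarrow> 'v) \<Rightarrow> ('e \<Rightarrow> 'v) \<Rightarrow> ('e \<Rightarrow> real) \<Rightarrow> bool" where
  "cooling_function E ends S init ter c \<longleftrightarrow>
     (\<forall>s \<in> S. (\<Sum>e \<in> {e \<in> edges_of E ends S. init e = s}. c e)
            - (\<Sum>e \<in> {e \<in> edges_of E ends S. ter e = s}. c e) \<ge> 1)"

(* The choice of orientation is immaterial: reversing an edge amounts to negating c on it. *)
definition admits_cooling_function :: "'e set \<Rightarrow> ('e \<Rightarrow> 'v set) \<Rightarrow> 'v set \<Rightarrow> bool" where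
  "admits_cooling_function E ends S \<longleftrightarrow>
     (\<exists>init ter c. orientation_for E ends S init ter \<and> cooling_function E ends S init ter c)"

(* Meant for subsets T of a finite set S admitting a cooling function: summing the cooling
   inequalities over a nonempty T shows that its edge boundary is nonempty, so the
   convention x / 0 = 0 plays no role there. *)
definition folner_ratio :: "'e set \<Rightarrow> ('e \<Rightarrow> 'v set) \<Rightarrow> 'v set \<Rightarrow> real" where
  "folner_ratio E ends T =
     (if T = {} then 0 else real (card T) / real (card (edge_boundary E ends T)))"

definition folner_optimal :: "'e set \<Rightarrow> ('e \<Rightarrow> 'v set) \<Rightarrow> 'v set \<Rightarrow> 'v set \<Rightarrow> bool" where
  "folner_optimal E ends S T \<longleftrightarrow>
     T \<subseteq> S \<and> folner_ratio E ends T = Max (folner_ratio E ends ` Pow S)"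

end

(* The boundary size is submodular while cardinality is modular. With M the maximal Folner ratio,
   |T| - M |boundary T| is thus supermodular, nonpositive on the subsets of S, and zero on the
   optimal ones; so a union of two optimal subsets is optimal. The cooling function serves only to
   make the boundary of every nonempty subset nonempty. *)
theory Submission
  imports Defs
begin

lemma edge_boundary_subset_edges_of: "edge_boundary E ends T \<subseteq> edges_of E ends T"
  by (auto simp: edge_boundary_def edges_of_def)

lemma (in locally_finite_graph) finite_edges_of:
  assumes "T \<subseteq> G" "finite T"
  shows "finite (edges_of E ends T)"
proof -
  have "edges_of E ends T = (\<Union>v\<in>T. {e \<in> E. v \<in> ends e})"
    by (auto simp: edges_of_def)
  then show ?thesis using assms locally_finite by auto
qed

lemma (in locally_finite_graph) finite_edge_boundary:
  assumes "T \<subseteq> G" "finite T"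
  shows "finite (edge_boundary E ends T)"
  using finite_subset[OF edge_boundary_subset_edges_of finite_edges_of[OF assms]] .

text \<open>An edge is counted on the left at most as often as on the right. If it leaves
  \<open>A \<union> B\<close> or \<open>A \<inter> B\<close>, it leaves \<open>A\<close> or
  \<open>B\<close>. If it leaves both, it joins \<open>A \<inter> B\<close> to the complement of
  \<open>A \<union> B\<close>, so it leaves both \<open>A\<close> and \<open>B\<close>.\<close>

lemma card_edge_boundary_submodular:
  assumes "finite (edge_boundary E ends A)" "finite (edge_boundary E ends B)"
  shows "card (edge_boundary E ends (A \<union> B)) + card (edge_boundary E ends (A \<inter> B))
    \<le> card (edge_boundary E ends A) + card (edge_boundary E ends B)"
proof -
  let ?d = "edge_boundary E ends"
  have un: "?d (A \<union> B) \<union> ?d (A \<inter> B) \<subseteq> ?d A \<union> ?d B"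
    and int: "?d (A \<union> B) \<inter> ?d (A \<inter> B) \<subseteq> ?d A \<inter> ?d B"
    by (auto simp: edge_boundary_def)
  have fin: "finite (?d (A \<union> B))" "finite (?d (A \<inter> B))"
    using finite_subset[OF un] assms by auto
  have "card (?d (A \<union> B)) + card (?d (A \<inter> B))
      = card (?d (A \<union> B) \<union> ?d (A \<inter> B)) + card (?d (A \<union> B) \<inter> ?d (A \<inter> B))"
    by (rule card_Un_Int[OF fin])
  also have "\<dots> \<le> card (?d A \<union> ?d B) + card (?d A \<inter> ?d B)"
    using assms by (intro add_mono card_mono un int) auto
  also have "\<dots> = card (?d A) + card (?d B)"
    by (rule card_Un_Int[OF assms, symmetric])
  finally show ?thesis .
qed

text \<open>If no edge left \<open>T\<close>, every edge meeting \<open>T\<close> would start and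
  end in \<open>T\<close>, so its \<open>c e\<close> would cancel in the sum of the cooling
  inequalities over \<open>T\<close>. That sum would then be 0, yet it is at least
  \<open>card T > 0\<close>.\<close>

lemma edge_boundary_nonempty:
  assumes fin: "finite (edges_of E ends S)" and "finite T" "T \<subseteq> S" "T \<noteq> {}"
    and "admits_cooling_function E ends S"
  shows "edge_boundary E ends T \<noteq> {}"
proof
  assume empty: "edge_boundary E ends T = {}"
  obtain init ter c where ori: "orientation_for E ends S init ter"
    and cool: "cooling_function E ends S init ter c"
    using assms(5) by (auto simp: admits_cooling_function_def)
  let ?ES = "edges_of E ends S"
  \<comment> \<open>The map \<open>h\<close> is arbitrary so that both \<open>init\<close> and
    \<open>ter\<close> can be substituted for it.\<close>
  have flow: "(\<Sum>s\<in>T. \<Sum>e\<in>{e \<in> ?ES. h e = s}. c e) = (\<Sum>e\<in>{e \<in> ?ES. h e \<in> T}. c e)"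
    for h :: "_ \<Rightarrow> _"
  proof -
    have "(\<Sum>s\<in>T. \<Sum>e\<in>{e \<in> {e \<in> ?ES. h e \<in> T}. h e = s}. c e) = (\<Sum>e\<in>{e \<in> ?ES. h e \<in> T}. c e)"
      using fin \<open>finite T\<close> by (intro sum.group) auto
    moreover have "{e \<in> {e \<in> ?ES. h e \<in> T}. h e = s} = {e \<in> ?ES. h e = s}" if "s \<in> T" for s
      using that by auto
    ultimately show ?thesis by simp
  qed
  have same: "{e \<in> ?ES. init e \<in> T} = {e \<in> ?ES. ter e \<in> T}"
  proof (rule Collect_cong, rule conj_cong[OF refl])
    fix e assume e: "e \<in> ?ES"
    then have "ends e = {init e, ter e}" using ori by (auto simp: orientation_for_def)
    moreover have "e \<in> E" using e by (simp add: edges_of_def)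
    ultimately show "init e \<in> T \<longleftrightarrow> ter e \<in> T"
      using empty by (auto simp: edge_boundary_def)
  qed
  have "real (card T) \<le> (\<Sum>s\<in>T. (\<Sum>e\<in>{e \<in> ?ES. init e = s}. c e) - (\<Sum>e\<in>{e \<in> ?ES. ter e = s}. c e))"
    using cool \<open>T \<subseteq> S\<close> sum_mono[of T "\<lambda>_. 1::real"]
    by (auto simp: cooling_function_def subset_eq)
  also have "\<dots> = 0"
    by (simp add: sum_subtractf flow same)
  finally show False using assms by simp
qed

text \<open>The ratio is traded for the linear inequality \<open>card T \<le> M * ?d T\<close>,
  whose nonempty equality cases are exactly the optimal subsets.\<close>

lemma (in locally_finite_graph) folner_optimal_Un:
  assumes "S \<subseteq> G" "finite S" "S \<noteq> {}" "admits_cooling_function E ends S"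
    and A: "folner_optimal E ends S A" and B: "folner_optimal E ends S B"
  shows "folner_optimal E ends S (A \<union> B)"
proof -
  let ?d = "\<lambda>T. real (card (edge_boundary E ends T))"
  define M where "M = Max (folner_ratio E ends ` Pow S)"
  have pos: "?d T > 0" if "T \<subseteq> S" "T \<noteq> {}" for T
  proof -
    have "finite T" using that assms finite_subset by blast
    moreover have "edge_boundary E ends T \<noteq> {}"
      using edge_boundary_nonempty[OF finite_edges_of] that assms calculation by blast
    ultimately show ?thesis
      using finite_edge_boundary[of T] that assms by (auto simp: card_gt_0_iff)
  qed
  have ratio_le: "folner_ratio E ends T \<le> M" if "T \<subseteq> S" for T
    unfolding M_def using that \<open>finite S\<close> by (intro Max_ge) auto
  \<comment> \<open>Positivity of \<open>M\<close> keeps the empty set, of ratio 0, from being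
    optimal, and lets submodularity be multiplied by \<open>M\<close>.\<close>
  have M0: "M > 0"
  proof -
    have "0 < folner_ratio E ends S"
      using pos[of S] assms(2,3) by (simp add: folner_ratio_def card_gt_0_iff)
    then show ?thesis using ratio_le[of S] by simp
  qed
  \<comment> \<open>The empty set is included because \<open>A \<inter> B\<close> may be
    empty.\<close>
  have le: "real (card T) \<le> M * ?d T" if "T \<subseteq> S" for T
  proof (cases "T = {}")
    case True
    then show ?thesis using M0 by simp
  next
    case False
    then show ?thesis
      using ratio_le[OF that] pos[OF that] by (simp add: folner_ratio_def divide_le_eq)
  qed
  have opt_M: "folner_optimal E ends S T \<longleftrightarrow> T \<subseteq> S \<and> folner_ratio E ends T = M" for T
    by (simp add: folner_optimal_def M_def)
  \<comment> \<open>The condition \<open>T \<noteq> {}\<close> must be explicit: the empty set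
    satisfies the equation as 0 = 0 without being optimal.\<close>
  have opt_iff: "folner_optimal E ends S T \<longleftrightarrow> T \<subseteq> S \<and> T \<noteq> {} \<and> real (card T) = M * ?d T" for T
  proof (cases "T \<subseteq> S \<and> T \<noteq> {}")
    case True
    then show ?thesis
      using pos[of T] by (simp add: opt_M folner_ratio_def divide_eq_eq)
  next
    case False
    then show ?thesis
      using M0 by (auto simp: opt_M folner_ratio_def)
  qed
  have sub: "A \<subseteq> S" "B \<subseteq> S" using A B by (auto simp: opt_iff)
  then have fin: "finite A" "finite B" using \<open>finite S\<close> finite_subset by auto
  have "?d (A \<union> B) + ?d (A \<inter> B) \<le> ?d A + ?d B"
    using card_edge_boundary_submodular[OF finite_edge_boundary finite_edge_boundary, of A B]
      sub fin \<open>S \<subseteq> G\<close> by (simp flip: of_nat_add)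
  then have "M * ?d (A \<union> B) + M * ?d (A \<inter> B) \<le> M * ?d A + M * ?d B"
    using M0 by (simp flip: distrib_left)
  also have "\<dots> = real (card A) + real (card B)"
    using A B by (simp add: opt_iff)
  also have "\<dots> = real (card (A \<union> B)) + real (card (A \<inter> B))"
    using card_Un_Int[OF fin] by linarith
  \<comment> \<open>The chain bounds the sum of the two terms \<open>M * ?d\<close> by the sum of
    the two cardinalities, while \<open>le\<close> gives the reverse bound for each term separately.
    Hence both bounds are equalities.\<close>
  finally have "real (card (A \<union> B)) = M * ?d (A \<union> B)"
    using le[of "A \<union> B"] le[of "A \<inter> B"] sub by fastforce
  then show ?thesis using A B by (auto simp: opt_iff)
qed

theorem theorem4p1:
  fixes G :: "'v set" and E :: "'e set" and ends :: "'e \<Rightarrow> 'v set" and S :: "'v set"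
  assumes "locally_finite_graph G E ends"
    and "S \<subseteq> G" and "finite S" and "S \<noteq> {}"
    and "admits_cooling_function E ends S"
  shows "\<exists>S0. folner_optimal E ends S S0 \<and> (\<forall>T. folner_optimal E ends S T \<longrightarrow> T \<subseteq> S0)"
proof -
  let ?O = "{T. folner_optimal E ends S T}"
  have "?O \<subseteq> Pow S" by (auto simp: folner_optimal_def)
  then have "finite ?O" using \<open>finite S\<close> finite_subset by auto
  moreover have "?O \<noteq> {}"
  proof -
    have "Max (folner_ratio E ends ` Pow S) \<in> folner_ratio E ends ` Pow S"
      using \<open>finite S\<close> by (intro Max_in) auto
    then show ?thesis by (auto simp: folner_optimal_def)
  qed
  ultimately obtain S0 where S0: "S0 \<in> ?O" and max: "\<forall>T\<in>?O. S0 \<subseteq> T \<longrightarrow> S0 = T"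
    using finite_has_maximal[of ?O] by blast
  \<comment> \<open>The union \<open>S0 \<union> T\<close> is optimal and contains
    \<open>S0\<close>, so it equals \<open>S0\<close> by maximality: closure under unions makes a
    maximal element a greatest one.\<close>
  have "T \<subseteq> S0" if "folner_optimal E ends S T" for T
    using locally_finite_graph.folner_optimal_Un[OF assms, of S0 T] S0 max that by blast
  then show ?thesis using S0 by blast
qed

end
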